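(* Let $M\ge2$ be an integer and let $\mathcal{A},\mathcal{B}\subset\{0,1,\dots,M-1\}$ with $0\in\mathcal{A}\cap\mathcal{B}$ and $1<|\mathcal{A}|=|\mathcal{B}|<M$. Then the following are equivalent: (1) $(\mathcal{A},\mathcal{B})$ is a spectral pair in $\mathbb{Z}_{M^2}$; (2) $\mathcal{A}=\{0,a\}$ and $\mathcal{B}=\{0,b\}$ for some integers $a,b$ with $2ab=M^2$ and $0<a,b<M$. Moreover, when these equivalent conditions hold, $(\mathcal{A},\mathcal{B})$ is a distributed spectral pair in $\mathbb{Z}_M$.
   Context: For a nonempty finite set $E\subset\mathbb{R}$, put $\widehat{\nu_E}(\xi)=\frac{1}{|E|}\sum_{a\in E}e^{-2\pi i\xi a}$ for $\xi\in\mathbb{R}$. Spectral pair: for an integer $N\ge1$, $(\mathcal{A},\mathcal{B})$ with $|\mathcal{A}|=|\mathcal{B}|$ is a spectral pair in $\mathbb{Z}_N$ if the matrix $\frac{1}{\sqrt{|\mathcal{A}|}}\left(e^{2\pi i ab/N}\right)_{a\in\mathcal{A},b\in\mathcal{B}}$ is unitary. Distributed spectral pair: $(\mathcal{A},\mathcal{B})$ with $|\mathcal{A}|=|\mathcal{B}|$ is a distributed spectral pair in $\mathbb{Z}_M$ if for all $b_1\neq b_1'$ in $\mathcal{B}$, either $\widehat{\nu_{\mathcal{A}}}\left(\frac{b_1-b_1'}{M}\right)=0$, or $\widehat{\nu_{\mathcal{A}}}\left(\frac{b_1-b_1'}{M^2}+\frac{b_2-b_2'}{M}\right)=0$ for all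 $b_2,b_2'\in\mathcal{B}$. *)

theory Defs
  imports "HOL-Analysis.Analysis"
begin

text \<open>Fourier transform of the uniform probability measure on a nonempty finite set of reals.\<close>

definition nu_hat :: "real set \<Rightarrow> real \<Rightarrow> complex" where
  "nu_hat E \<xi> = (1 / of_nat (card E)) * (\<Sum>a\<in>E. exp (- 2 * of_real pi * \<i> * of_real \<xi> * of_real a))"

text \<open>Unitarity of a complex matrix whose rows are indexed by \<open>I\<close> and whose columns are
  indexed by \<open>J\<close>: the products \<open>U U\<^sup>*\<close> and \<open>U\<^sup>* U\<close> are the identity matrices on \<open>I\<close> and \<open>J\<close>.\<close>

definition unitary_matrix_on :: "'i set \<Rightarrow> 'j set \<Rightarrow> ('i \<Rightarrow> 'j \<Rightarrow> complex) \<Rightarrow> bool" where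
  "unitary_matrix_on I J U \<longleftrightarrow> finite I \<and> finite J \<and>
     (\<forall>i\<in>I. \<forall>i'\<in>I. (\<Sum>j\<in>J. U i j * cnj (U i' j)) = (if i = i' then 1 else 0)) \<and>
     (\<forall>j\<in>J. \<forall>j'\<in>J. (\<Sum>i\<in>I. cnj (U i j) * U i j') = (if j = j' then 1 else 0))"

text \<open>Subsets of \<open>\<int>\<^sub>N\<close> are given by sets of integer representatives; unitarity forces the
  elements of each set to be pairwise incongruent modulo \<open>N\<close>.\<close>

definition spectral_pair :: "nat \<Rightarrow> int set \<Rightarrow> int set \<Rightarrow> bool" where
  "spectral_pair N A B \<longleftrightarrow> N \<ge> 1 \<and> finite A \<and> finite B \<and> card A = card B \<and>
     unitary_matrix_on A B (\<lambda>a b. (1 / of_real (sqrt (real (card A)))) *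
       exp (2 * of_real pi * \<i> * of_int a * of_int b / of_nat N))"

definition distributed_spectral_pair :: "nat \<Rightarrow> int set \<Rightarrow> int set \<Rightarrow> bool" where
  "distributed_spectral_pair M A B \<longleftrightarrow> M \<ge> 1 \<and> finite A \<and> finite B \<and> card A = card B \<and>
     (\<forall>b1\<in>B. \<forall>b1'\<in>B. b1 \<noteq> b1' \<longrightarrow>
        nu_hat (real_of_int ` A) (real_of_int (b1 - b1') / real M) = 0 \<or>
        (\<forall>b2\<in>B. \<forall>b2'\<in>B.
           nu_hat (real_of_int ` A)
             (real_of_int (b1 - b1') / real M ^ 2 + real_of_int (b2 - b2') / real M) = 0))"

end

theory Submission
  imports Defs
begin

text \<open>
  Orthogonality of the columns \<open>b \<noteq> b'\<close> of the matrix says that the unit vectors of angle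
  \<open>2\<pi> a (b' - b) / M\<^sup>2\<close>, with \<open>a\<close> in \<open>A\<close>, sum to zero. Unit vectors that all lie on a
  half-open half circle never do this (lemma \<open>sum_cis_half_circle_nonzero\<close>), so
  \<open>a (b' - b)\<close> has to reach \<open>M\<^sup>2 / 2\<close> for some \<open>a\<close>. But all elements of \<open>A\<close> are below \<open>M\<close>,
  and three points in \<open>{0..M-1}\<close> include two at distance at most \<open>(M - 1) / 2\<close>
  (lemma \<open>three_points_close_pair\<close>). Hence the sets have exactly two elements, and for
  \<open>A = {0, a}\<close>, \<open>B = {0, b}\<close> the single orthogonality relation \<open>1 + e\<^bsup>2\<pi>iab/M\<^sup>2\<^esup> = 0\<close> with
  \<open>0 < ab < M\<^sup>2\<close> forces \<open>2ab = M\<^sup>2\<close>.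

  For the last claim, \<open>2ab = M\<^sup>2\<close> makes \<open>M\<close> even. The transform of \<open>{0, a}\<close> vanishes at
  \<open>\<xi>\<close> as soon as \<open>2a\<xi>\<close> is an odd integer. Moving \<open>\<xi> = \<plusminus>b/M\<^sup>2\<close> by a multiple of \<open>b/M\<close> changes
  \<open>2a\<xi> = \<plusminus>1\<close> by a multiple of \<open>M\<close>, which is even, so the second alternative in the
  definition of a distributed spectral pair always holds.
\<close>

lemma exp_eq_cis: "exp (2 * of_real pi * \<i> * of_int a * of_int b / of_nat N) =
    cis (2 * pi * (of_int a * of_int b / of_nat N))"
  by (simp add: cis_conv_exp mult_ac)

lemma spectral_pair_columns_orthogonal:
  assumes "spectral_pair N A B" "b \<in> B" "b' \<in> B" "b \<noteq> b'"
  shows "(\<Sum>a\<in>A. cis (2 * pi * (of_int a * of_int (b' - b) / of_nat N))) = 0"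
proof (cases "card A = 0")
  case True
  then show ?thesis
    using assms(1) by (simp add: spectral_pair_def)
next
  case False
  let ?c = "1 / complex_of_real (sqrt (real (card A)))"
  let ?e = "\<lambda>a b. cis (2 * pi * (of_int a * of_int b / of_nat N))"
  have "cnj (?e a b) * ?e a b' = ?e a (b' - b)" for a
    by (simp add: cis_cnj cis_mult right_diff_distrib diff_divide_distrib)
  then have "cnj (?c * ?e a b) * (?c * ?e a b') = ?c * ?c * ?e a (b' - b)" for a
    by (simp add: mult.assoc mult.left_commute)
  moreover have "(\<Sum>a\<in>A. cnj (?c * ?e a b) * (?c * ?e a b')) = 0"
    using assms unfolding spectral_pair_def unitary_matrix_on_def exp_eq_cis by auto
  ultimately have "?c * ?c * (\<Sum>a\<in>A. ?e a (b' - b)) = 0"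
    by (simp only: sum_distrib_left)
  then show ?thesis
    using False by simp
qed

text \<open>If the sum vanished, then so would its imaginary part, a sum of nonnegative sines; this
  forces every angle to be \<open>0\<close>, but then the sum is the number of its terms.\<close>

lemma sum_cis_half_circle_nonzero:
  assumes "finite S" "S \<noteq> {}" and arc: "\<And>s. s \<in> S \<Longrightarrow> 0 \<le> \<theta> s \<and> \<theta> s < pi"
  shows "(\<Sum>s\<in>S. cis (\<theta> s)) \<noteq> 0"
proof
  assume zero: "(\<Sum>s\<in>S. cis (\<theta> s)) = 0"
  have "(\<Sum>s\<in>S. sin (\<theta> s)) = Im (\<Sum>s\<in>S. cis (\<theta> s))"
    by simp
  then have "\<forall>s\<in>S. sin (\<theta> s) = 0"
    using zero assms sum_nonneg_eq_0_iff[of S "\<lambda>s. sin (\<theta> s)"]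
    by (simp add: sin_ge_zero less_imp_le)
  then have "\<theta> s = 0" if "s \<in> S" for s
    using arc[OF that] that sin_gt_zero[of "\<theta> s"] by fastforce
  then have "(\<Sum>s\<in>S. cis (\<theta> s)) = of_nat (card S)"
    by simp
  then show False
    using zero assms by simp
qed

lemma three_points_close_pair:
  fixes B :: "int set"
  assumes "B \<subseteq> {0..m}" "card B \<ge> 3"
  obtains b b' where "b \<in> B" "b' \<in> B" "b < b'" "2 * (b' - b) \<le> m"
proof -
  obtain T where "T \<subseteq> B" "card T = 3"
    using obtain_subset_with_card_n[OF assms(2)] by metis
  then obtain x y z where xyz: "x \<in> B" "y \<in> B" "z \<in> B" "x \<noteq> y" "x \<noteq> z" "y \<noteq> z"
    by (auto simp: card_3_iff)
  moreover have "x \<in> {0..m}" "y \<in> {0..m}" "z \<in> {0..m}"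
    using xyz assms(1) by auto
  ultimately have "\<exists>b\<in>B. \<exists>b'\<in>B. b < b' \<and> 2 * (b' - b) \<le> m"
    by (smt (verit) atLeastAtMost_iff)
  then show ?thesis
    using that by blast
qed

text \<open>The product of an element of \<open>A\<close> with a difference of at most \<open>(M - 1) / 2\<close> stays below
  \<open>M\<^sup>2 / 2\<close>, so a close pair of columns would put all phases on half a circle.\<close>

lemma spectral_pair_short_card_le_2:
  assumes A: "A \<subseteq> {0..int M - 1}" "A \<noteq> {}" and B: "B \<subseteq> {0..int M - 1}"
    and sp: "spectral_pair (M ^ 2) A B"
  shows "card B \<le> 2"
proof (rule ccontr)
  assume "\<not> card B \<le> 2"
  then obtain b b' where b: "b \<in> B" "b' \<in> B" "b < b'" "2 * (b' - b) \<le> int M - 1"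
    using three_points_close_pair[OF B] by auto
  let ?\<theta> = "\<lambda>a. 2 * pi * (of_int a * of_int (b' - b) / of_nat (M ^ 2))"
  have "0 \<le> ?\<theta> a \<and> ?\<theta> a < pi" if "a \<in> A" for a
  proof -
    have a: "0 \<le> a" "a \<le> int M - 1"
      using that A by auto
    have "a * (2 * (b' - b)) \<le> (int M - 1) * (int M - 1)"
      using a b by (intro mult_mono) auto
    also have "\<dots> < int M ^ 2"
      using a by (simp add: power2_eq_square algebra_simps)
    finally have "real_of_int (2 * (a * (b' - b))) < real_of_int (int M ^ 2)"
      by (simp only: of_int_less_iff mult_ac)
    then have "2 * (of_int a * of_int (b' - b) / of_nat (M ^ 2)) < (1::real)"
      using a by (simp add: divide_less_eq)
    then have "pi * (2 * (of_int a * of_int (b' - b) / of_nat (M ^ 2))) < pi * 1"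
      by (intro mult_strict_left_mono) auto
    then show ?thesis
      using a b by (simp add: mult_ac)
  qed
  moreover have "finite A"
    using A(1) finite_subset by blast
  ultimately have "(\<Sum>a\<in>A. cis (?\<theta> a)) \<noteq> 0"
    using A(2) by (intro sum_cis_half_circle_nonzero)
  then show False
    using spectral_pair_columns_orthogonal[OF sp] b by auto
qed

lemma one_plus_cis_eq_0_iff:
  assumes "0 < t" "t < 1"
  shows "1 + cis (2 * pi * t) = 0 \<longleftrightarrow> t = 1 / 2"
proof
  assume "1 + cis (2 * pi * t) = 0"
  then have "cos (2 * pi * t) = - 1"
    by (simp add: complex_eq_iff)
  then obtain k :: int where "2 * pi * t = (2 * of_int k + 1) * pi"
    by (auto simp: cos_eq_minus1 algebra_simps)
  then have t: "2 * t = 2 * of_int k + 1"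
    by simp
  then have "k = 0"
    using assms by linarith
  then show "t = 1 / 2"
    using t by simp
next
  assume "t = 1 / 2"
  then have "2 * pi * t = pi"
    by simp
  then show "1 + cis (2 * pi * t) = 0"
    by (metis cis_pi add.right_inverse)
qed

lemma spectral_pair_two_points:
  assumes "a \<noteq> 0" "b \<noteq> 0" "2 * a * b = int N" "N \<ge> 1"
  shows "spectral_pair N {0, a} {0, b}"
proof -
  have "2 * (of_int a * of_int b) = real N"
    using assms(3) by (metis mult.assoc of_int_mult of_int_numeral of_int_of_nat_eq)
  then have "of_int a * of_int b / real N = 1 / 2"
    using assms(4) by (simp add: divide_eq_eq)
  then have e: "cis (2 * pi * (of_int a * of_int b / real N)) = - 1"
    by (simp only:) simp
  have s: "complex_of_real (sqrt 2) * complex_of_real (sqrt 2) = 2"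
    by (simp flip: of_real_mult)
  show ?thesis
    unfolding spectral_pair_def unitary_matrix_on_def exp_eq_cis
    using assms(1,2,4) e s by auto
qed

lemma nu_hat_two_points_zero:
  assumes "a \<noteq> 0" "2 * a * \<xi> = of_int k" "odd k"
  shows "nu_hat {0, a} \<xi> = 0"
proof -
  have "exp (- 2 * of_real pi * \<i> * of_real \<xi> * of_real a) = cis (- (pi * (2 * a * \<xi>)))"
    by (simp add: cis_conv_exp mult_ac)
  also have "\<dots> = cis (- (pi * of_int k))"
    by (simp only: assms(2))
  also have "\<dots> = - 1"
    using assms(3) by (auto simp: complex_eq_iff elim!: oddE)
  finally show ?thesis
    using assms(1) by (simp add: nu_hat_def)
qed

text \<open>Writing the two differences as \<open>s * b\<close> and \<open>t * b\<close>, with \<open>s = \<plusminus>1\<close>, the relevant frequency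
  \<open>\<xi>\<close> satisfies \<open>2a\<xi> = s + t * M\<close>.\<close>

lemma distributed_spectral_pair_two_points:
  assumes "a \<noteq> 0" "b \<noteq> 0" and ab: "2 * a * b = int M ^ 2" and "M \<ge> 1"
  shows "distributed_spectral_pair M {0, a} {0, b}"
proof -
  have "even (int M ^ 2)"
    unfolding ab[symmetric] by simp
  then have "even M"
    by simp
  have ab': "2 * of_int a * of_int b = real M ^ 2"
    using arg_cong[OF ab, of real_of_int] by simp
  have zero: "nu_hat {0, of_int a} (of_int (s * b) / real M ^ 2 + of_int (t * b) / real M) = 0"
    if "odd s" for s t :: int
  proof (rule nu_hat_two_points_zero)
    have "2 * of_int a * (of_int (s * b) / real M ^ 2 + of_int (t * b) / real M) =
        (2 * of_int a * of_int b) * (of_int s / real M ^ 2 + of_int t / real M)"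
      by (simp add: algebra_simps)
    also have "\<dots> = of_int (s + t * int M)"
      unfolding ab' using \<open>M \<ge> 1\<close> by (simp add: field_simps power2_eq_square)
    finally show "2 * of_int a * (of_int (s * b) / real M ^ 2 + of_int (t * b) / real M) =
        of_int (s + t * int M)" .
    show "odd (s + t * int M)"
      using that \<open>even M\<close> by simp
  qed (use assms in simp)
  have "nu_hat (real_of_int ` {0, a})
      (real_of_int (b1 - b1') / real M ^ 2 + real_of_int (b2 - b2') / real M) = 0"
    if "b1 \<in> {0, b}" "b1' \<in> {0, b}" "b1 \<noteq> b1'" "b2 \<in> {0, b}" "b2' \<in> {0, b}" for b1 b1' b2 b2'
  proof -
    have "\<exists>s. odd s \<and> b1 - b1' = s * b"
      using that(1-3) by (auto intro: exI[of _ 1] exI[of _ "- 1"])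
    moreover have "\<exists>t. b2 - b2' = t * b"
      using that(4,5) by (auto intro: exI[of _ 0] exI[of _ 1] exI[of _ "- 1"])
    ultimately obtain s t where "odd s" "b1 - b1' = s * b" "b2 - b2' = t * b"
      by blast
    then show ?thesis
      using zero[of s t] by (simp del: of_int_mult of_int_diff)
  qed
  then show ?thesis
    using assms by (auto simp: distributed_spectral_pair_def)
qed

theorem theorem3p2:
  fixes M :: nat and A B :: "int set"
  assumes "M \<ge> 2"
    and "A \<subseteq> {0..int M - 1}" and "B \<subseteq> {0..int M - 1}"
    and "0 \<in> A \<inter> B"
    and "1 < card A" and "card A = card B" and "card B < M"
  shows "(spectral_pair (M ^ 2) A B \<longleftrightarrow>
            (\<exists>a b :: int. A = {0, a} \<and> B = {0, b} \<and> 2 * a * b = int M ^ 2 \<and>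
               0 < a \<and> a < int M \<and> 0 < b \<and> b < int M))
         \<and> (spectral_pair (M ^ 2) A B \<longrightarrow> distributed_spectral_pair M A B)"
proof -
  have two: "\<exists>a b. A = {0, a} \<and> B = {0, b} \<and> 2 * a * b = int M ^ 2 \<and>
      0 < a \<and> a < int M \<and> 0 < b \<and> b < int M" if sp: "spectral_pair (M ^ 2) A B"
  proof -
    have "card B \<le> 2"
      using assms sp by (intro spectral_pair_short_card_le_2[of A M B]) auto
    then have "card A = 2" "card B = 2"
      using assms by auto
    then obtain a b where ab: "A = {0, a}" "B = {0, b}" "a \<noteq> 0" "b \<noteq> 0"
      using assms(4) by (auto simp: card_2_iff doubleton_eq_iff)
    have bounds: "0 < a" "a < int M" "0 < b" "b < int M"
      using ab assms(2,3) by auto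
    let ?t = "of_int a * of_int b / of_nat (M ^ 2) :: real"
    have "a * b < int M * int M"
      using bounds by (intro mult_strict_mono) auto
    then have "real_of_int (a * b) < real_of_int (int M * int M)"
      by (simp only: of_int_less_iff)
    then have t: "0 < ?t" "?t < 1"
      using bounds assms(1) by (simp_all add: power2_eq_square divide_less_eq)
    have "1 + cis (2 * pi * ?t) = 0"
      using spectral_pair_columns_orthogonal[OF sp, of 0 b] ab by simp
    then have "?t = 1 / 2"
      using one_plus_cis_eq_0_iff[OF t] by blast
    then have "real_of_int (2 * a * b) = real_of_int (int M ^ 2)"
      using assms(1) by (simp add: divide_eq_eq)
    then have "2 * a * b = int M ^ 2"
      by (simp only: of_int_eq_iff)
    then show ?thesis
      using ab bounds by blast
  qed
  moreover have "spectral_pair (M ^ 2) A B \<and> distributed_spectral_pair M A B"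
    if "A = {0, a}" "B = {0, b}" "2 * a * b = int M ^ 2" "0 < a" "0 < b" for a b
    using that assms(1) spectral_pair_two_points[of a b "M ^ 2"]
      distributed_spectral_pair_two_points[of a b M]
    by simp
  ultimately show ?thesis
    by blast
qed

end
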